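(* Let $\bm{\mu}=(\mu_1,\dots,\mu_r)$ be probability measures on $\partial\mathbb{D}$ with Carathéodory functions $F_1,\dots,F_r$. Let $\bm{n}=(n_1,\dots,n_r)\in\mathbb{N}^r$ with $n_j$ even for all $j$, and put $\ell_j=n_j/2$, $|\bm{\ell}|=|\bm{n}|/2$. Consider the Hermite–Padé problem of finding Laurent polynomials $$\varphi_{\bm{n}},\psi_{\bm{n},1},\dots,\psi_{\bm{n},r}\in\operatorname{span}\{z^k\}_{k=-|\bm{\ell}|}^{|\bm{\ell}|}\qquad(1)$$ such that for all $j=1,\dots,r$ $$\varphi_{\bm{n}}(z)F_j(z)+\psi_{\bm{n},j}(z)=\mathcal{O}(z^{\ell_j}),\quad z\to0,\qquad(2)$$ $$\varphi_{\bm{n}}(z)F_j(z)+\psi_{\bm{n},j}(z)=\mathcal{O}(z^{-\ell_j-1}),\quad z\to\infty.\qquad(3)$$ Any Laurent polynomial $\varphi_{\bm{n}}$ that solves (1)–(3) (with some $\psi_{\bm{n},1},\dots,\psi_{\bm{n},r}$) satisfies the orthogonality relations $$\int\varphi_{\bm{n}}(z)z^{-k}\,d\mu_j(z)=0,\qquad k=-\ell_j,-\ell_j+1,\dots,\ell_j-1,\quad j=1,\dots,r.\qquad(4)$$ Moreover, the Laurent polynomials $\psi_{\bm{n},j}$ can be expressed in terms of $\varphi_{\bm{n}}$ by $$\psi_{\bm{n},j}(z)=\int\frac{w+z}{w-z}\big(\varphi_{\bm{n}}(w)-\varphi_{\bm{n}}(z)\big)\,d\mu_j(w)+\int\varphi_{\bm{n}}(w)\,d\mu_j(w).\qquad(5)$$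 Conversely, any $\varphi_{\bm{n}}\in\operatorname{span}\{z^k\}_{k=-|\bm{\ell}|}^{|\bm{\ell}|}$ that satisfies (4) solves the Hermite–Padé problem (1)–(3) together with the $\psi_{\bm{n},j}$ given by (5).
   Context: $\mathbb{N}=\{0,1,2,\dots\}$; $\partial\mathbb{D}=\{z\in\mathbb{C}:|z|=1\}$; $|\bm{n}|=n_1+\dots+n_r$. The Carathéodory function of $\mu_j$ is $F_j(z)=\int_{\partial\mathbb{D}}\frac{w+z}{w-z}\,d\mu_j(w)$, $z\in\mathbb{C}\setminus\partial\mathbb{D}$. Spans are over $\mathbb{C}$. If $\ell_j=0$, the list of orthogonality conditions for that $j$ is empty. *)

theory Defs
  imports
    "HOL-Probability.Probability"
    "HOL-Complex_Analysis.Complex_Analysis"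
    "HOL-Library.Landau_Symbols"
begin

definition prob_measure_on_circle :: "complex measure \<Rightarrow> bool" where
  "prob_measure_on_circle \<mu> \<longleftrightarrow>
     prob_space \<mu> \<and> sets \<mu> = sets (restrict_space borel (sphere (0::complex) 1))"

definition caratheodory_fun :: "complex measure \<Rightarrow> complex \<Rightarrow> complex" where
  "caratheodory_fun \<mu> z = (LINT w|\<mu>. (w + z) / (w - z))"

text \<open>
  Laurent polynomials are functions on the punctured plane: a function of type
  \<^typ>\<open>complex \<Rightarrow> complex\<close> belongs to the span of the monomials
  iff it agrees with a linear combination of them away from \<open>0\<close>, and
  its value at \<open>0\<close> is irrelevant.
\<close>

definition laurent_span :: "nat \<Rightarrow> (complex \<Rightarrow> complex) set" where
  "laurent_span N =
     {f. \<exists>a :: int \<Rightarrow> complex. \<forall>z. z \<noteq> 0 \<longrightarrow> f z = (\<Sum>k\<in>{- int N..int N}. a k * z powi k)}"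

definition hermite_pade_solution ::
    "nat \<Rightarrow> (nat \<Rightarrow> nat) \<Rightarrow> (nat \<Rightarrow> complex measure) \<Rightarrow>
     (complex \<Rightarrow> complex) \<Rightarrow> (nat \<Rightarrow> complex \<Rightarrow> complex) \<Rightarrow> bool" where
  "hermite_pade_solution r n \<mu> \<phi> \<psi> \<longleftrightarrow>
     \<phi> \<in> laurent_span ((\<Sum>j=1..r. n j) div 2) \<and>
     (\<forall>j\<in>{1..r}.
        \<psi> j \<in> laurent_span ((\<Sum>j=1..r. n j) div 2) \<and>
        (\<lambda>z. \<phi> z * caratheodory_fun (\<mu> j) z + \<psi> j z)
           \<in> O[at 0](\<lambda>z. z ^ (n j div 2)) \<and>
        (\<lambda>z. \<phi> z * caratheodory_fun (\<mu> j) z + \<psi> j z)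
           \<in> O[at_infinity](\<lambda>z. z powi (- int (n j div 2) - 1)))"

definition orthogonality_relations ::
    "nat \<Rightarrow> (nat \<Rightarrow> nat) \<Rightarrow> (nat \<Rightarrow> complex measure) \<Rightarrow> (complex \<Rightarrow> complex) \<Rightarrow> bool" where
  "orthogonality_relations r n \<mu> \<phi> \<longleftrightarrow>
     (\<forall>j\<in>{1..r}. \<forall>k\<in>{- int (n j div 2)..int (n j div 2) - 1}.
        (LINT z|\<mu> j. \<phi> z * z powi (- k)) = 0)"

text \<open>
  For \<open>z\<close> on the unit circle the integrand \<open>(w + z) / (w - z) * (\<phi> w - \<phi> z)\<close> has a removable
  singularity at \<open>w = z\<close>, which matters if \<open>\<mu>\<close> has an atom there; \<^const>\<open>remove_sings\<close> inserts
  the limit instead of the value \<open>0\<close> that division by zero would give. Off the circle it has no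
  effect, as the lemma below shows.
\<close>

definition second_kind_fun :: "complex measure \<Rightarrow> (complex \<Rightarrow> complex) \<Rightarrow> complex \<Rightarrow> complex" where
  "second_kind_fun \<mu> \<phi> z =
     (LINT w|\<mu>. remove_sings (\<lambda>w. (w + z) / (w - z) * (\<phi> w - \<phi> z)) w) + (LINT w|\<mu>. \<phi> w)"

lemma second_kind_fun_off_circle:
  assumes \<mu>: "prob_measure_on_circle \<mu>" and \<phi>: "\<phi> \<in> laurent_span N" and z: "norm z \<noteq> 1"
  shows "second_kind_fun \<mu> \<phi> z =
     (LINT w|\<mu>. (w + z) / (w - z) * (\<phi> w - \<phi> z)) + (LINT w|\<mu>. \<phi> w)"
proof -
  obtain a where a: "\<And>z. z \<noteq> 0 \<Longrightarrow> \<phi> z = (\<Sum>k\<in>{- int N..int N}. a k * z powi k)"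
    using \<phi> by (auto simp: laurent_span_def)
  have space: "space \<mu> = sphere 0 1"
    using \<mu> sets_eq_imp_space_eq[of \<mu> "restrict_space borel (sphere (0::complex) 1)"]
    by (auto simp: prob_measure_on_circle_def space_restrict_space)
  have "remove_sings (\<lambda>w. (w + z) / (w - z) * (\<phi> w - \<phi> z)) w
          = (w + z) / (w - z) * (\<phi> w - \<phi> z)" if "w \<in> space \<mu>" for w
  proof (rule remove_sings_eqI)
    have w: "w \<noteq> 0" "w \<noteq> z" using that z by (auto simp: space)
    have "((\<lambda>w. \<Sum>k\<in>{- int N..int N}. a k * w powi k) \<longlongrightarrow>
            (\<Sum>k\<in>{- int N..int N}. a k * w powi k)) (at w)"
      using w by (intro tendsto_intros) auto
    moreover have "eventually (\<lambda>v. \<phi> v = (\<Sum>k\<in>{- int N..int N}. a k * v powi k)) (at w)"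
      using eventually_neq_at_within[of 0 w UNIV] by eventually_elim (simp add: a)
    ultimately have "(\<phi> \<longlongrightarrow> \<phi> w) (at w)"
      using a[OF w(1)] tendsto_cong by fastforce
    then show "((\<lambda>w. (w + z) / (w - z) * (\<phi> w - \<phi> z)) \<longlongrightarrow>
                 (w + z) / (w - z) * (\<phi> w - \<phi> z)) (at w)"
      using w by (intro tendsto_intros) auto
  qed
  then show ?thesis
    unfolding second_kind_fun_def by (simp cong: Bochner_Integration.integral_cong)
qed

end

theory Submission
  imports Defs
begin

text \<open>
  Off the unit circle, \<open>(w + z) / (w - z) + 1 = 2 w / (w - z)\<close> shows that with \<open>\<psi>\<close> given by (5)
  the remainder \<open>\<phi> F + \<psi>\<close> is \<open>H z = \<integral> \<phi> w * 2 w / (w - z) d\<mu>\<close>. Expanding the kernel into geometric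
  series, the coefficients of \<open>H\<close> at \<open>0\<close> and at \<open>\<infinity>\<close> are, up to the factors \<open>2\<close> and \<open>-2\<close>, the
  moments \<open>\<integral> \<phi> w * w\<^sup>-\<^sup>k d\<mu>\<close> with \<open>k \<ge> 0\<close> and \<open>k < 0\<close>, so the order conditions on \<open>H\<close> are exactly the
  orthogonality relations. If \<open>\<psi>\<close> is an arbitrary solution, its difference from (5) is a Laurent
  polynomial that is bounded near \<open>0\<close> and vanishes at \<open>\<infinity>\<close>, hence is zero by Liouville.
\<close>

section \<open>Integration over the unit circle\<close>

lemma space_prob_measure_on_circle:
  "prob_measure_on_circle \<mu> \<Longrightarrow> space \<mu> = sphere 0 1"
  using sets_eq_imp_space_eq[of \<mu> "restrict_space borel (sphere (0::complex) 1)"]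
  by (auto simp: prob_measure_on_circle_def space_restrict_space)

lemma continuous_on_circle_bounded:
  fixes f :: "complex \<Rightarrow> complex"
  assumes "continuous_on (sphere 0 1) f"
  obtains B where "\<And>w. norm w = 1 \<Longrightarrow> norm (f w) \<le> B"
proof -
  have "bounded (f ` sphere 0 1)"
    by (intro compact_imp_bounded compact_continuous_image assms compact_sphere)
  then obtain B where "\<And>x. x \<in> f ` sphere 0 1 \<Longrightarrow> norm x \<le> B"
    unfolding bounded_iff by blast
  then show ?thesis
    by (intro that[of B]) simp
qed

lemma integrable_continuous_on_circle:
  fixes f :: "complex \<Rightarrow> complex"
  assumes \<mu>: "prob_measure_on_circle \<mu>" and f: "continuous_on (sphere 0 1) f"
  shows "integrable \<mu> f"
proof -
  interpret prob_space \<mu>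
    using \<mu> by (simp add: prob_measure_on_circle_def)
  obtain B where B: "\<And>w. norm w = 1 \<Longrightarrow> norm (f w) \<le> B"
    using continuous_on_circle_bounded[OF f] by blast
  have "f \<in> borel_measurable (restrict_space borel (sphere 0 1))"
    by (rule borel_measurable_continuous_on_restrict[OF f])
  then have "f \<in> borel_measurable \<mu>"
    using \<mu> measurable_cong_sets[OF _ refl] unfolding prob_measure_on_circle_def by blast
  then show ?thesis
    using B by (intro integrable_const_bound[where B = B])
      (auto simp: space_prob_measure_on_circle[OF \<mu>])
qed

text \<open>Total mass one passes a pointwise bound on to the integral unchanged. This estimates the
  tails of both expansions of the remainder.\<close>

lemma norm_integral_on_circle_le:
  fixes f :: "complex \<Rightarrow> complex"
  assumes \<mu>: "prob_measure_on_circle \<mu>" and f: "continuous_on (sphere 0 1) f"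
    and B: "\<And>w. norm w = 1 \<Longrightarrow> norm (f w) \<le> B"
  shows "norm (LINT w|\<mu>. f w) \<le> B"
proof -
  interpret prob_space \<mu>
    using \<mu> by (simp add: prob_measure_on_circle_def)
  have "norm (LINT w|\<mu>. f w) \<le> (LINT w|\<mu>. norm (f w))"
    by (rule integral_norm_bound)
  also have "\<dots> \<le> (LINT w|\<mu>. B)"
    using B integrable_continuous_on_circle[OF \<mu> f]
    by (intro integral_mono) (auto simp: space_prob_measure_on_circle[OF \<mu>])
  finally show ?thesis
    by (simp add: prob_space)
qed

lemma integral_on_circle_cong:
  assumes "prob_measure_on_circle \<mu>" "\<And>w. norm w = 1 \<Longrightarrow> f w = g w"
  shows "(LINT w|\<mu>. f w) = (LINT w|\<mu>. g w)"
  by (rule Bochner_Integration.integral_cong) (use assms in \<open>auto simp: space_prob_measure_on_circle\<close>)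

section \<open>Regularity of Laurent polynomials\<close>

lemma laurent_span_continuous_on:
  assumes "\<phi> \<in> laurent_span N" "0 \<notin> S"
  shows "continuous_on S \<phi>"
proof -
  obtain a where a: "\<And>z. z \<noteq> 0 \<Longrightarrow> \<phi> z = (\<Sum>k\<in>{- int N..int N}. a k * z powi k)"
    using assms by (auto simp: laurent_span_def)
  have "continuous_on S (\<lambda>z. \<Sum>k\<in>{- int N..int N}. a k * z powi k)"
    using assms(2) by (intro continuous_intros) auto
  then show ?thesis
    using a assms(2) by (metis (no_types, lifting) continuous_on_cong)
qed

lemma laurent_span_diff_holomorphic_on:
  assumes "f \<in> laurent_span N" "g \<in> laurent_span N"
  shows "(\<lambda>z. f z - g z) holomorphic_on (UNIV - {0})"
proof -
  have *: "h holomorphic_on (UNIV - {0})" if h: "h \<in> laurent_span N" for h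
  proof -
    obtain a where a: "\<And>z. z \<noteq> 0 \<Longrightarrow> h z = (\<Sum>k\<in>{- int N..int N}. a k * z powi k)"
      using h by (auto simp: laurent_span_def)
    have "(\<lambda>z. \<Sum>k\<in>{- int N..int N}. a k * z powi k) holomorphic_on (UNIV - {0})"
      by (intro holomorphic_intros) auto
    then show ?thesis
      by (rule holomorphic_transform) (simp add: a)
  qed
  show ?thesis
    by (intro holomorphic_intros * assms)
qed

section \<open>\<open>second_kind_fun\<close> as a Laurent polynomial\<close>

text \<open>With \<open>K = (w + z) / (w - z)\<close>, the induction rests on \<open>K * (w ^ Suc m
  - z ^ Suc m) = w * (K * (w ^ m - z ^ m)) + w * z ^ m + z ^ Suc m\<close>. Homogeneity of degree
  \<open>m\<close> in \<open>w\<close> and \<open>z\<close> fixes the power of \<open>w\<close>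
  beside \<open>z powi i\<close>. The bound \<open>m \<le> N\<close> gives all exponents one common
  index range, that of \<open>laurent_span N\<close>.\<close>

lemma kernel_nat_power_expansion:
  "m \<le> N \<Longrightarrow> \<exists>b :: int \<Rightarrow> complex. \<forall>w z. w \<noteq> 0 \<longrightarrow> z \<noteq> 0 \<longrightarrow> w \<noteq> z \<longrightarrow>
     (w + z) / (w - z) * (w ^ m - z ^ m) =
     (\<Sum>i\<in>{- int N..int N}. b i * w powi (int m - i) * z powi i)"
proof (induction m)
  case 0
  then show ?case
    by (intro exI[of _ "\<lambda>_. 0"]) simp
next
  case (Suc m)
  then obtain b :: "int \<Rightarrow> complex" where b: "\<And>w z. w \<noteq> 0 \<Longrightarrow> z \<noteq> 0 \<Longrightarrow> w \<noteq> z \<Longrightarrow>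
     (w + z) / (w - z) * (w ^ m - z ^ m) =
     (\<Sum>i\<in>{- int N..int N}. b i * w powi (int m - i) * z powi i)"
    by (meson Suc_leD)
  \<comment> \<open>The factor \<open>w\<close> of the recursion only raises the exponent of
    \<open>w\<close> in the old terms; the two new monomials add 1 to the coefficients at
    \<open>int m\<close> and \<open>int (Suc m)\<close>.\<close>
  define b' where "b' i = b i + (if i = int m then 1 else 0) + (if i = int (Suc m) then 1 else 0)"
    for i
  show ?case
  proof (intro exI[of _ b'] allI impI)
    fix w z :: complex
    assume wz: "w \<noteq> 0" "z \<noteq> 0" "w \<noteq> z"
    have "(\<Sum>i\<in>{- int N..int N}. b' i * w powi (int (Suc m) - i) * z powi i) =
        (\<Sum>i\<in>{- int N..int N}. w * (b i * w powi (int m - i) * z powi i) +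
           (if i = int m then w * z ^ m else 0) + (if i = int (Suc m) then z ^ Suc m else 0))"
    proof (rule sum.cong[OF refl])
      fix i
      have "w powi (int (Suc m) - i) = w * w powi (int m - i)"
        using wz(1) power_int_add_1'[of w "int m - i"] by (simp add: algebra_simps)
      then show "b' i * w powi (int (Suc m) - i) * z powi i =
          w * (b i * w powi (int m - i) * z powi i) +
          (if i = int m then w * z ^ m else 0) + (if i = int (Suc m) then z ^ Suc m else 0)"
        using power_int_of_nat[of z "Suc m"] by (auto simp: b'_def algebra_simps)
    qed
    also have "\<dots> = w * ((w + z) / (w - z) * (w ^ m - z ^ m)) + w * z ^ m + z ^ Suc m"
      using Suc.prems unfolding b[OF wz] by (simp add: sum.distrib sum_distrib_left)
    also have "\<dots> = (w + z) / (w - z) * (w ^ Suc m - z ^ Suc m)"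
      using wz by (simp add: divide_simps) (simp add: algebra_simps)
    finally show "(w + z) / (w - z) * (w ^ Suc m - z ^ Suc m) =
        (\<Sum>i\<in>{- int N..int N}. b' i * w powi (int (Suc m) - i) * z powi i)" ..
  qed
qed

text \<open>The kernel changes sign when \<open>w\<close> and \<open>z\<close> are replaced by their
  inverses, so negative exponents reduce to natural ones.\<close>

lemma kernel_powi_expansion:
  assumes "k \<in> {- int N..int N}"
  shows "\<exists>b :: int \<Rightarrow> complex. \<forall>w z. w \<noteq> 0 \<longrightarrow> z \<noteq> 0 \<longrightarrow> w \<noteq> z \<longrightarrow>
     (w + z) / (w - z) * (w powi k - z powi k) =
     (\<Sum>i\<in>{- int N..int N}. b i * w powi (k - i) * z powi i)"
proof -
  define m where "m = nat \<bar>k\<bar>"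
  have "m \<le> N"
    using assms by (auto simp: m_def)
  from kernel_nat_power_expansion[OF this] obtain b :: "int \<Rightarrow> complex"
    where b: "\<And>w z. w \<noteq> 0 \<Longrightarrow> z \<noteq> 0 \<Longrightarrow> w \<noteq> z \<Longrightarrow>
     (w + z) / (w - z) * (w ^ m - z ^ m) =
     (\<Sum>i\<in>{- int N..int N}. b i * w powi (int m - i) * z powi i)"
    by blast
  show ?thesis
  proof (cases "k \<ge> 0")
    case True
    then have "k = int m"
      by (simp add: m_def)
    then show ?thesis
      using b by (intro exI[of _ b]) simp
  next
    case False
    then have k: "k = - int m"
      by (simp add: m_def)
    show ?thesis
    \<comment> \<open>The minus sign is that of the inverted kernel, and \<open>- i\<close> arises
      because \<open>inverse z powi i\<close> is \<open>z powi (- i)\<close>; the symmetric index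
      range is stable under this reflection.\<close>
    proof (intro exI[of _ "\<lambda>i. - b (- i)"] allI impI)
      fix w z :: complex
      assume wz: "w \<noteq> 0" "z \<noteq> 0" "w \<noteq> z"
      have "(w + z) / (w - z) = - ((inverse w + inverse z) / (inverse w - inverse z))"
        using wz by (simp add: field_simps)
      then have "(w + z) / (w - z) * (w powi k - z powi k) =
          - ((inverse w + inverse z) / (inverse w - inverse z) * (inverse w ^ m - inverse z ^ m))"
        by (simp add: k power_int_minus power_inverse)
      also have "\<dots> =
          - (\<Sum>i\<in>{- int N..int N}. b i * inverse w powi (int m - i) * inverse z powi i)"
        using wz by (subst b) auto
      also have "\<dots> = (\<Sum>i\<in>{- int N..int N}. - b (- i) * w powi (k - i) * z powi i)"
        unfolding sum_negf[symmetric]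
      proof (rule sum.reindex_bij_witness[of _ uminus uminus])
        fix i
        have "inverse w powi (int m - i) = w powi (k + i)"
          using power_int_minus[of w "int m - i"] by (simp add: k power_int_inverse)
        moreover have "inverse z powi i = z powi (- i)"
          by (simp add: power_int_minus power_int_inverse)
        ultimately show "- b (- (- i)) * w powi (k - - i) * z powi (- i) =
            - (b i * inverse w powi (int m - i) * inverse z powi i)"
          by simp
      qed auto
      finally show "(w + z) / (w - z) * (w powi k - z powi k) =
          (\<Sum>i\<in>{- int N..int N}. - b (- i) * w powi (k - i) * z powi i)" .
    qed
  qed
qed

text \<open>Integrating the kernel expansions of the monomials of \<phi> over \<open>w\<close>
  leaves a Laurent polynomial in \<open>z\<close> with the same range of exponents, whose
  coefficients are built from moments of \<mu>.\<close>

lemma second_kind_fun_in_laurent_span: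
  assumes \<mu>: "prob_measure_on_circle \<mu>" and \<phi>: "\<phi> \<in> laurent_span N"
  shows "second_kind_fun \<mu> \<phi> \<in> laurent_span N"
proof -
  let ?I = "{- int N..int N}"
  obtain a where a: "\<And>z. z \<noteq> 0 \<Longrightarrow> \<phi> z = (\<Sum>k\<in>?I. a k * z powi k)"
    using \<phi> by (auto simp: laurent_span_def)
  have "\<forall>k\<in>?I. \<exists>b :: int \<Rightarrow> complex. \<forall>w z. w \<noteq> 0 \<longrightarrow> z \<noteq> 0 \<longrightarrow> w \<noteq> z \<longrightarrow>
     (w + z) / (w - z) * (w powi k - z powi k) = (\<Sum>i\<in>?I. b i * w powi (k - i) * z powi i)"
    by (intro ballI kernel_powi_expansion)
  from bchoice[OF this] obtain b :: "int \<Rightarrow> int \<Rightarrow> complex"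
    where b: "\<forall>k\<in>?I. \<forall>w z. w \<noteq> 0 \<longrightarrow> z \<noteq> 0 \<longrightarrow> w \<noteq> z \<longrightarrow>
     (w + z) / (w - z) * (w powi k - z powi k) = (\<Sum>i\<in>?I. b k i * w powi (k - i) * z powi i)" ..
  \<comment> \<open>\<open>P\<close> is the integrand written without division, hence meaningful at
    \<open>w = z\<close> too. For \<open>z\<close> on the circle it supplies the limit that
    \<open>remove_sings\<close> takes there.\<close>
  define P where "P w z = (\<Sum>k\<in>?I. a k * (\<Sum>i\<in>?I. b k i * w powi (k - i) * z powi i))" for w z
  define c where "c i = (\<Sum>k\<in>?I. a k * b k i * (LINT w|\<mu>. w powi (k - i)))" for i
  have int: "integrable \<mu> (\<lambda>w. w powi k)" for k
    by (intro integrable_continuous_on_circle[OF \<mu>] continuous_intros) auto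
  have "second_kind_fun \<mu> \<phi> z =
      (\<Sum>i\<in>?I. (c i + (if i = 0 then LINT w|\<mu>. \<phi> w else 0)) * z powi i)" if z: "z \<noteq> 0" for z
  proof -
    have P: "(v + z) / (v - z) * (\<phi> v - \<phi> z) = P v z" if "v \<noteq> 0" "v \<noteq> z" for v
    proof -
      have "(v + z) / (v - z) * (\<phi> v - \<phi> z) =
          (\<Sum>k\<in>?I. a k * ((v + z) / (v - z) * (v powi k - z powi k)))"
        unfolding a[OF that(1)] a[OF z] sum_subtractf[symmetric] sum_distrib_left
        by (simp only: right_diff_distrib mult.left_commute)
      also have "\<dots> = P v z"
        unfolding P_def by (intro sum.cong refl) (simp only: b[rule_format, OF _ that(1) z that(2)])
      finally show ?thesis .
    qed
    have "remove_sings (\<lambda>w. (w + z) / (w - z) * (\<phi> w - \<phi> z)) w = P w z" if w: "norm w = 1" for w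
    proof (rule remove_sings_eqI)
      have "w \<noteq> 0"
        using w by auto
      then have "((\<lambda>v. P v z) \<longlongrightarrow> P w z) (at w)"
        unfolding P_def by (intro tendsto_intros) auto
      moreover have "\<forall>\<^sub>F v in at w. P v z = (v + z) / (v - z) * (\<phi> v - \<phi> z)"
        using eventually_neq_at_within[of 0 w UNIV] eventually_neq_at_within[of z w UNIV]
        by eventually_elim (rule P[symmetric])
      ultimately show "((\<lambda>w. (w + z) / (w - z) * (\<phi> w - \<phi> z)) \<longlongrightarrow> P w z) (at w)"
        by (rule Lim_transform_eventually)
    qed
    then have "(LINT w|\<mu>. remove_sings (\<lambda>w. (w + z) / (w - z) * (\<phi> w - \<phi> z)) w) =
        (LINT w|\<mu>. P w z)"
      by (rule integral_on_circle_cong[OF \<mu>])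
    also have "\<dots> = (\<Sum>k\<in>?I. a k * (\<Sum>i\<in>?I. b k i * (LINT w|\<mu>. w powi (k - i)) * z powi i))"
      unfolding P_def
      by (simp only: Bochner_Integration.integral_sum Bochner_Integration.integrable_sum
          integrable_mult_left integrable_mult_right int
          integral_mult_right_zero integral_mult_left_zero)
    also have "\<dots> = (\<Sum>i\<in>?I. c i * z powi i)"
      unfolding c_def sum_distrib_left sum_distrib_right
      by (subst sum.swap) (simp only: mult_ac)
    finally have "second_kind_fun \<mu> \<phi> z = (\<Sum>i\<in>?I. c i * z powi i) + (LINT w|\<mu>. \<phi> w)"
      by (simp only: second_kind_fun_def)
    also have "(LINT w|\<mu>. \<phi> w) = (\<Sum>i\<in>?I. (if i = 0 then LINT w|\<mu>. \<phi> w else 0) * z powi i)"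
      by (subst sum.remove[of _ 0]) auto
    finally show ?thesis
      by (simp only: distrib_right sum.distrib)
  qed
  then show ?thesis
    unfolding laurent_span_def
    by (intro CollectI exI[of _ "\<lambda>i. c i + (if i = 0 then LINT w|\<mu>. \<phi> w else 0)"] allI impI)
qed

section \<open>The remainder as an integral, and its expansions at 0 and infinity\<close>

text \<open>The factor \<open>w powi k\<close> is the weight that the tails of the geometric sums
  put beside the kernel: \<open>k = - int l\<close> at 0 and \<open>k = int l\<close> at
  infinity.\<close>

lemma continuous_on_circle_kernel:
  assumes "\<phi> \<in> laurent_span N" "norm z \<noteq> 1"
  shows "continuous_on (sphere 0 1) (\<lambda>w. \<phi> w * w powi k * (2 * w / (w - z)))"
  by (intro continuous_intros laurent_span_continuous_on[OF assms(1)]) (use assms in auto)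

text \<open>Under the integral the terms with \<open>\<phi> z\<close> cancel, which leaves
  \<open>\<phi> w\<close> times \<open>(w + z) / (w - z) + 1\<close>. For \<open>z\<close> off the
  circle no denominator vanishes and \<open>remove_sings\<close> has no effect.\<close>

lemma remainder_eq_integral:
  assumes \<mu>: "prob_measure_on_circle \<mu>" and \<phi>: "\<phi> \<in> laurent_span N" and z: "norm z \<noteq> 1"
  shows "\<phi> z * caratheodory_fun \<mu> z + second_kind_fun \<mu> \<phi> z =
    (LINT w|\<mu>. \<phi> w * (2 * w / (w - z)))"
proof -
  have int: "integrable \<mu> (\<lambda>w. (w + z) / (w - z))"
      "integrable \<mu> (\<lambda>w. (w + z) / (w - z) * (\<phi> w - \<phi> z))" "integrable \<mu> \<phi>"
    by (intro integrable_continuous_on_circle[OF \<mu>] continuous_intros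
          laurent_span_continuous_on[OF \<phi>]; use z in auto)+
  have "\<phi> z * caratheodory_fun \<mu> z + second_kind_fun \<mu> \<phi> z =
     (LINT w|\<mu>. \<phi> z * ((w + z) / (w - z)) + ((w + z) / (w - z) * (\<phi> w - \<phi> z) + \<phi> w))"
    unfolding second_kind_fun_off_circle[OF \<mu> \<phi> z] caratheodory_fun_def
    using int by (simp del: times_divide_eq_left times_divide_eq_right)
  also have "\<dots> = (LINT w|\<mu>. \<phi> w * (2 * w / (w - z)))"
  proof (rule integral_on_circle_cong[OF \<mu>])
    fix w :: complex
    assume "norm w = 1"
    then have "w \<noteq> z"
      using z by auto
    then show "\<phi> z * ((w + z) / (w - z)) + ((w + z) / (w - z) * (\<phi> w - \<phi> z) + \<phi> w) =
        \<phi> w * (2 * w / (w - z))"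
      by (simp add: divide_simps) (simp add: algebra_simps)
  qed
  finally show ?thesis .
qed

text \<open>Keeping the tail in closed form leaves only finite sums, which commute with the integral
  by linearity.\<close>

lemma geometric_sum_remainder:
  fixes q :: complex
  shows "q \<noteq> 1 \<Longrightarrow> 1 / (1 - q) = (\<Sum>k<l. q ^ k) + q ^ l * (1 / (1 - q))"
  by (simp add: sum_gp_strict add_divide_distrib[symmetric])

text \<open>Geometric expansion of \<open>2 * w / (w - z) = 2 / (1 - z / w)\<close> in powers of
  \<open>z / w\<close>. The order \<open>l\<close> stays free: 0 gives mere boundedness of the
  remainder, the prescribed order gives the moments.\<close>

lemma remainder_expansion_at_0:
  assumes \<mu>: "prob_measure_on_circle \<mu>" and \<phi>: "\<phi> \<in> laurent_span N"
  shows "(\<lambda>z. (\<phi> z * caratheodory_fun \<mu> z + second_kind_fun \<mu> \<phi> z) -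
      (\<Sum>k<l. 2 * (LINT w|\<mu>. \<phi> w * w powi (- int k)) * z ^ k)) \<in> O[at 0](\<lambda>z. z ^ l)"
proof -
  obtain B where B: "\<And>w. norm w = 1 \<Longrightarrow> norm (\<phi> w) \<le> B"
    by (rule continuous_on_circle_bounded[OF laurent_span_continuous_on[OF \<phi>]]) auto
  \<comment> \<open>The radius 1/2 keeps \<open>z\<close> at distance at least 1/2 from the circle;
    the kernel is then at most 4 in norm, which yields \<open>4 * B\<close>.\<close>
  have "norm ((\<phi> z * caratheodory_fun \<mu> z + second_kind_fun \<mu> \<phi> z) -
      (\<Sum>k<l. 2 * (LINT w|\<mu>. \<phi> w * w powi (- int k)) * z ^ k)) \<le> (4 * B) * norm (z ^ l)"
    if z: "norm z < 1/2" for z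
  proof -
    have z1: "norm z \<noteq> 1"
      using z by auto
    have int: "integrable \<mu> (\<lambda>w. \<phi> w * w powi i)" for i
      by (intro integrable_continuous_on_circle[OF \<mu>] continuous_intros
          laurent_span_continuous_on[OF \<phi>]) auto
    have int': "integrable \<mu> (\<lambda>w. \<phi> w * w powi i * (2 * w / (w - z)))" for i
      by (intro integrable_continuous_on_circle[OF \<mu>] continuous_on_circle_kernel[OF \<phi> z1])
    have "(LINT w|\<mu>. \<phi> w * (2 * w / (w - z))) =
        (LINT w|\<mu>. (\<Sum>k<l. 2 * (\<phi> w * w powi (- int k)) * z ^ k) +
           z ^ l * (\<phi> w * w powi (- int l) * (2 * w / (w - z))))"
    proof (rule integral_on_circle_cong[OF \<mu>])
      fix w :: complex
      assume w: "norm w = 1"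
      have nz: "w \<noteq> 0" "w \<noteq> z"
        using w z by auto
      have kernel: "2 * w / (w - z) = 2 * (1 / (1 - z / w))"
        using nz by (simp add: divide_simps)
      have *: "2 * w / (w - z) = 2 * (\<Sum>k<l. (z / w) ^ k) + (z / w) ^ l * (2 * w / (w - z))"
        unfolding kernel using arg_cong[OF geometric_sum_remainder, of "z / w" "\<lambda>x. 2 * x" l] nz
        by (simp only: ring_distribs mult_ac) simp
      have "\<phi> w * (2 * w / (w - z)) =
          (\<Sum>k<l. 2 * \<phi> w * (z / w) ^ k) + \<phi> w * (z / w) ^ l * (2 * w / (w - z))"
        by (subst *) (simp only: ring_distribs sum_distrib_left mult_ac)
      then show "\<phi> w * (2 * w / (w - z)) = (\<Sum>k<l. 2 * (\<phi> w * w powi (- int k)) * z ^ k) +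
           z ^ l * (\<phi> w * w powi (- int l) * (2 * w / (w - z)))"
        by (simp add: power_int_minus power_divide field_simps)
    qed
    also have "\<dots> = (\<Sum>k<l. 2 * (LINT w|\<mu>. \<phi> w * w powi (- int k)) * z ^ k) +
           z ^ l * (LINT w|\<mu>. \<phi> w * w powi (- int l) * (2 * w / (w - z)))"
      by (subst Bochner_Integration.integral_add)
        (simp_all only: Bochner_Integration.integral_sum Bochner_Integration.integrable_sum
          integrable_mult_left integrable_mult_right int int'
          integral_mult_right_zero integral_mult_left_zero)
    finally have "(\<phi> z * caratheodory_fun \<mu> z + second_kind_fun \<mu> \<phi> z) -
        (\<Sum>k<l. 2 * (LINT w|\<mu>. \<phi> w * w powi (- int k)) * z ^ k) =
        z ^ l * (LINT w|\<mu>. \<phi> w * w powi (- int l) * (2 * w / (w - z)))"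
      by (simp add: remainder_eq_integral[OF \<mu> \<phi> z1])
    moreover have "norm (LINT w|\<mu>. \<phi> w * w powi (- int l) * (2 * w / (w - z))) \<le> 4 * B"
    proof (rule norm_integral_on_circle_le[OF \<mu> continuous_on_circle_kernel[OF \<phi> z1]])
      fix w :: complex
      assume w: "norm w = 1"
      have "1/2 \<le> norm (w - z)"
        using norm_triangle_ineq2[of w z] w z by simp
      then have "2 / norm (w - z) \<le> 4"
        by (simp add: divide_simps)
      then have "norm (\<phi> w) * (2 / norm (w - z)) \<le> B * 4"
        using B[OF w] norm_ge_zero[of "\<phi> w"] by (intro mult_mono) (linarith | simp)+
      then show "norm (\<phi> w * w powi (- int l) * (2 * w / (w - z))) \<le> 4 * B"
        using w by (simp add: norm_mult norm_divide norm_power_int)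
    qed
    ultimately show ?thesis
      by (simp add: norm_mult mult.commute mult_left_mono)
  qed
  moreover have "\<forall>\<^sub>F z :: complex in at 0. norm z < 1/2"
    using eventually_at_ball[of "1/2" "0 :: complex" UNIV] by (simp add: dist_norm)
  ultimately show ?thesis
    by (intro bigoI[where c = "4 * B"]) (auto elim!: eventually_mono)
qed

text \<open>Here the kernel is \<open>- 2 * (w / z) / (1 - w / z)\<close>, expanded in powers of
  \<open>w / z\<close>. The prefactor accounts for the sign and for the shift by one:
  \<open>z powi (- int k - 1)\<close> carries the moment with
  \<open>w powi (int k + 1)\<close>.\<close>

lemma remainder_expansion_at_infinity:
  assumes \<mu>: "prob_measure_on_circle \<mu>" and \<phi>: "\<phi> \<in> laurent_span N"
  shows "(\<lambda>z. (\<phi> z * caratheodory_fun \<mu> z + second_kind_fun \<mu> \<phi> z) -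
      (\<Sum>k<l. - 2 * (LINT w|\<mu>. \<phi> w * w powi (int k + 1)) * z powi (- int k - 1)))
      \<in> O[at_infinity](\<lambda>z. z powi (- int l - 1))"
proof -
  obtain B where B: "\<And>w. norm w = 1 \<Longrightarrow> norm (\<phi> w) \<le> B"
    by (rule continuous_on_circle_bounded[OF laurent_span_continuous_on[OF \<phi>]]) auto
  have "norm ((\<phi> z * caratheodory_fun \<mu> z + second_kind_fun \<mu> \<phi> z) -
      (\<Sum>k<l. - 2 * (LINT w|\<mu>. \<phi> w * w powi (int k + 1)) * z powi (- int k - 1)))
      \<le> (4 * B) * norm (z powi (- int l - 1))"
    if z: "norm z \<ge> 2" for z
  proof -
    have z1: "norm z \<noteq> 1" and z0: "z \<noteq> 0"
      using z by auto
    have powi: "x powi (int i + 1) = x * x ^ i" "x powi (- int i - 1) = inverse x * inverse x ^ i"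
      if "x \<noteq> 0" for x :: complex and i
      using that by (simp_all add: power_int_add power_int_diff power_int_minus power_inverse
          divide_inverse mult.commute)
    have int: "integrable \<mu> (\<lambda>w. \<phi> w * w powi i)" for i
      by (intro integrable_continuous_on_circle[OF \<mu>] continuous_intros
          laurent_span_continuous_on[OF \<phi>]) auto
    have int': "integrable \<mu> (\<lambda>w. \<phi> w * w powi i * (2 * w / (w - z)))" for i
      by (intro integrable_continuous_on_circle[OF \<mu>] continuous_on_circle_kernel[OF \<phi> z1])
    have "(LINT w|\<mu>. \<phi> w * (2 * w / (w - z))) =
        (LINT w|\<mu>. (\<Sum>k<l. - 2 * (\<phi> w * w powi (int k + 1)) * z powi (- int k - 1)) +
           z powi (- int l) * (\<phi> w * w powi (int l) * (2 * w / (w - z))))"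
    proof (rule integral_on_circle_cong[OF \<mu>])
      fix w :: complex
      assume w: "norm w = 1"
      have nz: "w \<noteq> 0" "w \<noteq> z"
        using w z by auto
      have kernel: "2 * w / (w - z) = - 2 * (w / z) * (1 / (1 - w / z))"
        using nz z0 by (simp add: divide_simps) (simp add: algebra_simps)
      have *: "2 * w / (w - z) =
          - 2 * (w / z) * (\<Sum>k<l. (w / z) ^ k) + (w / z) ^ l * (2 * w / (w - z))"
        unfolding kernel
        using arg_cong[OF geometric_sum_remainder, of "w / z" "\<lambda>x. - 2 * (w / z) * x" l] nz z0
        by (simp only: ring_distribs mult_ac) simp
      have "\<phi> w * (2 * w / (w - z)) =
          (\<Sum>k<l. - 2 * \<phi> w * (w / z) * (w / z) ^ k) + \<phi> w * (w / z) ^ l * (2 * w / (w - z))"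
        by (subst *) (simp only: ring_distribs sum_distrib_left mult_ac)
      then show "\<phi> w * (2 * w / (w - z)) =
          (\<Sum>k<l. - 2 * (\<phi> w * w powi (int k + 1)) * z powi (- int k - 1)) +
           z powi (- int l) * (\<phi> w * w powi (int l) * (2 * w / (w - z)))"
        using nz z0 by (simp add: powi power_int_minus power_divide divide_inverse power_inverse
            power_mult_distrib mult_ac)
    qed
    also have "\<dots> = (\<Sum>k<l. - 2 * (LINT w|\<mu>. \<phi> w * w powi (int k + 1)) * z powi (- int k - 1)) +
           z powi (- int l) * (LINT w|\<mu>. \<phi> w * w powi (int l) * (2 * w / (w - z)))"
      by (subst Bochner_Integration.integral_add)
        (simp_all only: Bochner_Integration.integral_sum Bochner_Integration.integrable_sum
          integrable_mult_left integrable_mult_right int int'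
          integral_mult_right_zero integral_mult_left_zero)
    finally have "(\<phi> z * caratheodory_fun \<mu> z + second_kind_fun \<mu> \<phi> z) -
        (\<Sum>k<l. - 2 * (LINT w|\<mu>. \<phi> w * w powi (int k + 1)) * z powi (- int k - 1)) =
        z powi (- int l) * (LINT w|\<mu>. \<phi> w * w powi (int l) * (2 * w / (w - z)))"
      by (simp add: remainder_eq_integral[OF \<mu> \<phi> z1])
    \<comment> \<open>The factor \<open>z powi (- int l)\<close> is one power short of the claimed
      order. The missing \<open>1 / z\<close> is the decay of the kernel: for
      \<open>norm z \<ge> 2\<close> the distance to the circle is at least
      \<open>norm z / 2\<close>.\<close>
    moreover have "norm (LINT w|\<mu>. \<phi> w * w powi (int l) * (2 * w / (w - z))) \<le> 4 * B / norm z"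
    proof (rule norm_integral_on_circle_le[OF \<mu> continuous_on_circle_kernel[OF \<phi> z1]])
      fix w :: complex
      assume w: "norm w = 1"
      have "norm z / 2 \<le> norm (w - z)"
        using norm_triangle_ineq2[of z w] w z by (simp add: norm_minus_commute)
      moreover have "norm z > 0"
        using z0 by simp
      ultimately have "2 / norm (w - z) \<le> 4 / norm z"
        by (simp add: divide_simps)
      then have "norm (\<phi> w) * (2 / norm (w - z)) \<le> B * (4 / norm z)"
        using B[OF w] norm_ge_zero[of "\<phi> w"] by (intro mult_mono) (linarith | simp)+
      then show "norm (\<phi> w * w powi (int l) * (2 * w / (w - z))) \<le> 4 * B / norm z"
        using w by (simp add: norm_mult norm_divide norm_power mult.commute)
    qed
    then have "norm (z powi (- int l)) * norm (LINT w|\<mu>. \<phi> w * w powi (int l) * (2 * w / (w - z)))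
        \<le> norm (z powi (- int l)) * (4 * B / norm z)"
      by (intro mult_left_mono) auto
    moreover have "z powi (- int l - 1) = z powi (- int l) / z"
      using z0 by (simp add: power_int_diff)
    ultimately show ?thesis
      by (simp add: norm_mult norm_divide mult_ac)
  qed
  moreover have "\<forall>\<^sub>F z :: complex in at_infinity. norm z \<ge> 2"
    by (auto simp: eventually_at_infinity)
  ultimately show ?thesis
    by (intro bigoI[where c = "4 * B"]) (auto elim!: eventually_mono)
qed

section \<open>Comparison of orders and vanishing of coefficients\<close>

lemma power_bigo_at_0:
  "m \<le> l \<Longrightarrow> (\<lambda>z::complex. z ^ l) \<in> O[at 0](\<lambda>z. z ^ m)"
proof (rule bigoI[where c = 1])
  assume "m \<le> l"
  have "\<forall>\<^sub>F z :: complex in at 0. norm z < 1"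
    using eventually_at_ball[of 1 "0 :: complex" UNIV] by (simp add: dist_norm)
  then show "\<forall>\<^sub>F z :: complex in at 0. norm (z ^ l) \<le> 1 * norm (z ^ m)"
    by eventually_elim (use \<open>m \<le> l\<close> in \<open>simp add: norm_power power_decreasing\<close>)
qed

lemma powi_bigo_at_infinity:
  "(\<lambda>z::complex. z powi (- int l - 1)) \<in> O[at_infinity](\<lambda>z. z powi (- 1))"
proof (rule bigoI[where c = 1])
  have "\<forall>\<^sub>F z :: complex in at_infinity. norm z \<ge> 1"
    by (auto simp: eventually_at_infinity)
  then show "\<forall>\<^sub>F z :: complex in at_infinity. norm (z powi (- int l - 1)) \<le> 1 * norm (z powi (- 1))"
    by eventually_elim (simp add: norm_power_int power_int_increasing del: power_int_minus1_right)
qed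

text \<open>The top term itself has order \<open>z ^ l\<close>, so after subtracting it the
  induction hypothesis kills the lower coefficients. Then \<open>c l * z ^ l\<close> alone has order
  \<open>z ^ Suc l\<close>, and dividing by \<open>z ^ l\<close> and letting \<open>z\<close> tend
  to 0 gives \<open>c l = 0\<close>.\<close>

lemma coeffs_eq_0_if_bigo_at_0:
  fixes c :: "nat \<Rightarrow> complex"
  assumes "(\<lambda>z. \<Sum>k<l. c k * z ^ k) \<in> O[at 0](\<lambda>z. z ^ l)" "k < l"
  shows "c k = 0"
  using assms
proof (induction l arbitrary: k)
  case 0
  then show ?case
    by blast
next
  case (Suc l)
  have "(\<lambda>z. \<Sum>k<Suc l. c k * z ^ k) \<in> O[at 0](\<lambda>z. z ^ l)"
    by (rule landau_o.big_trans[OF Suc.prems(1) power_bigo_at_0]) simp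
  moreover have "(\<lambda>z. c l * z ^ l) \<in> O[at 0](\<lambda>z. z ^ l)"
    by simp
  ultimately have "(\<lambda>z. (\<Sum>k<Suc l. c k * z ^ k) - c l * z ^ l) \<in> O[at 0](\<lambda>z. z ^ l)"
    by (rule sum_in_bigo)
  then have "(\<lambda>z. \<Sum>k<l. c k * z ^ k) \<in> O[at 0](\<lambda>z. z ^ l)"
    by (simp only: sum.lessThan_Suc add_diff_cancel_right')
  then have less: "c k = 0" if "k < l" for k
    using that by (rule Suc.IH)
  then have "(\<Sum>k<Suc l. c k * z ^ k) = c l * z ^ l" for z
    by simp
  then have "(\<lambda>z. c l * z ^ l) \<in> O[at 0](\<lambda>z. z ^ Suc l)"
    using Suc.prems(1) by (simp only:)
  then obtain C where "\<forall>\<^sub>F z in at 0. norm (c l * z ^ l) \<le> C * norm (z ^ Suc l)"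
    by (rule landau_o.bigE) blast
  moreover have "\<forall>\<^sub>F z :: complex in at 0. z \<noteq> 0"
    by (rule eventually_neq_at_within)
  ultimately have "\<forall>\<^sub>F z :: complex in at 0. norm (c l) \<le> C * norm z"
  proof eventually_elim
    case (elim z)
    then have "norm (c l) * norm (z ^ l) \<le> (C * norm z) * norm (z ^ l)"
      by (simp only: norm_mult power_Suc mult.assoc)
    moreover have "norm (z ^ l) > 0"
      using elim(2) by simp
    ultimately show ?case
      by (rule mult_right_le_imp_le)
  qed
  moreover have "((\<lambda>z :: complex. C * norm z) \<longlongrightarrow> C * norm (0 :: complex)) (at 0)"
    by (intro tendsto_intros)
  ultimately have "norm (c l) \<le> C * norm (0 :: complex)"
    by (intro tendsto_lowerbound[where F = "at (0 :: complex)"]) auto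
  then show ?case
    using less Suc.prems(2) by (cases "k = l") auto
qed

text \<open>Inversion carries infinity to 0 and turns \<open>z powi (- int k - 1)\<close> into
  \<open>z ^ Suc k\<close>.\<close>

lemma coeffs_eq_0_if_bigo_at_infinity:
  fixes c :: "nat \<Rightarrow> complex"
  assumes "(\<lambda>z. \<Sum>k<l. c k * z powi (- int k - 1)) \<in> O[at_infinity](\<lambda>z. z powi (- int l - 1))"
    and "k < l"
  shows "c k = 0"
proof -
  \<comment> \<open>The inverted sum has no constant term, hence the value 0 at index 0 and the
    shift of \<open>c\<close> by one; the order likewise becomes \<open>Suc l\<close>.\<close>
  define c' where "c' i = (if i = 0 then 0 else c (i - 1))" for i
  have powi: "inverse z powi (- int i - 1) = z ^ Suc i" for z :: complex and i
  proof -
    have "- int i - 1 = - int (Suc i)"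
      by simp
    then show ?thesis
      by (simp only: power_int_minus power_int_of_nat power_inverse inverse_inverse_eq)
  qed
  have "(\<lambda>z. \<Sum>k<l. c k * inverse z powi (- int k - 1))
      \<in> O[at 0](\<lambda>z. inverse z powi (- int l - 1))"
    by (rule landau_o.big.compose[OF assms(1) filterlim_inverse_at_infinity])
  then have "(\<lambda>z. \<Sum>k<Suc l. c' k * z ^ k) \<in> O[at 0](\<lambda>z. z ^ Suc l)"
    unfolding powi by (simp add: c'_def sum.lessThan_Suc_shift del: sum.lessThan_Suc)
  from coeffs_eq_0_if_bigo_at_0[OF this, of "Suc k"] show ?thesis
    using assms(2) by (simp add: c'_def)
qed

section \<open>Uniqueness by Liouville's theorem\<close>

text \<open>Boundedness near 0 makes the singularity of the difference removable, and decay at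
  infinity makes the resulting entire function zero. The point 0 is excluded because
  \<open>laurent_span\<close> leaves the values there arbitrary.\<close>

lemma laurent_span_eq_if_bigo:
  assumes f: "f \<in> laurent_span N" and g: "g \<in> laurent_span N"
    and 0: "(\<lambda>z. f z - g z) \<in> O[at 0](\<lambda>_. 1)"
    and inf: "(\<lambda>z. f z - g z) \<in> O[at_infinity](\<lambda>z. z powi (- 1))"
    and z: "z \<noteq> 0"
  shows "f z = g z"
proof -
  obtain B where "\<forall>\<^sub>F z in at 0. norm (f z - g z) \<le> B * norm (1::complex)"
    using 0 by (rule landau_o.bigE) blast
  then have "\<exists>B. \<forall>\<^sub>F z in at 0. norm (f z - g z) \<le> B"
    by auto
  then obtain h where h: "h holomorphic_on UNIV" "\<And>z. z \<noteq> 0 \<Longrightarrow> h z = f z - g z"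
    using holomorphic_on_extend_bounded[OF laurent_span_diff_holomorphic_on[OF f g]] by auto
  obtain C where "\<forall>\<^sub>F z in at_infinity. norm (f z - g z) \<le> C * norm (z powi (- 1))"
    using inf by (rule landau_o.bigE) blast
  then have "\<forall>\<^sub>F z in at_infinity. norm (f z - g z) \<le> norm (inverse z) * C"
    by (simp add: mult.commute)
  moreover have "((\<lambda>z :: complex. inverse z) \<longlongrightarrow> 0) at_infinity"
    by (rule tendsto_inverse_0)
  ultimately have "((\<lambda>z. f z - g z) \<longlongrightarrow> 0) at_infinity"
    by (rule tendsto_0_le[rotated])
  moreover have "\<forall>\<^sub>F z in at_infinity. f z - g z = h z"
    using eventually_not_equal_at_infinity[of 0] by eventually_elim (rule h(2)[symmetric])
  ultimately have "(h \<longlongrightarrow> 0) at_infinity"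
    by (rule Lim_transform_eventually)
  from Liouville_weak_0[OF h(1) this] h(2)[OF z] show ?thesis
    by simp
qed

section \<open>Order conditions and orthogonality\<close>

text \<open>The remainders of the given \<psi> and of \<open>second_kind_fun\<close> are both
  bounded near 0 and of order \<open>1 / z\<close> at infinity, so the two Laurent polynomials agree
  and the moments can be read off from the expansions. For \<open>l = 0\<close> there are no moment
  conditions, but \<psi> is still determined.\<close>

lemma remainder_bigo_imp:
  assumes \<mu>: "prob_measure_on_circle \<mu>" and \<phi>: "\<phi> \<in> laurent_span N" and \<psi>: "\<psi> \<in> laurent_span N"
    and 0: "(\<lambda>z. \<phi> z * caratheodory_fun \<mu> z + \<psi> z) \<in> O[at 0](\<lambda>z. z ^ l)"
    and inf: "(\<lambda>z. \<phi> z * caratheodory_fun \<mu> z + \<psi> z) \<in> O[at_infinity](\<lambda>z. z powi (- int l - 1))"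
  shows "\<And>z. z \<noteq> 0 \<Longrightarrow> \<psi> z = second_kind_fun \<mu> \<phi> z"
    and "\<And>k. k \<in> {- int l..int l - 1} \<Longrightarrow> (LINT z|\<mu>. \<phi> z * z powi (- k)) = 0"
proof -
  define R where "R z = \<phi> z * caratheodory_fun \<mu> z + \<psi> z" for z
  define H where "H z = \<phi> z * caratheodory_fun \<mu> z + second_kind_fun \<mu> \<phi> z" for z
  note H_0 = remainder_expansion_at_0[OF \<mu> \<phi>, folded H_def]
  note H_inf = remainder_expansion_at_infinity[OF \<mu> \<phi>, folded H_def]
  have R_0: "R \<in> O[at 0](\<lambda>z. z ^ l)" and R_inf: "R \<in> O[at_infinity](\<lambda>z. z powi (- int l - 1))"
    using 0 inf by (simp_all add: R_def[abs_def])
  have diff: "\<psi> z - second_kind_fun \<mu> \<phi> z = R z - H z" for z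
    by (simp add: R_def H_def)
  show eq: "\<psi> z = second_kind_fun \<mu> \<phi> z" if "z \<noteq> 0" for z
  proof (rule laurent_span_eq_if_bigo[OF \<psi> second_kind_fun_in_laurent_span[OF \<mu> \<phi>] _ _ that])
    \<comment> \<open>\<open>R\<close> is weakened to the orders that \<open>H\<close> has
      unconditionally: its expansions of length 0 have an empty sum.\<close>
    have "R \<in> O[at 0](\<lambda>z. z ^ 0)"
      by (rule landau_o.big_trans[OF R_0 power_bigo_at_0]) simp
    then show "(\<lambda>z. \<psi> z - second_kind_fun \<mu> \<phi> z) \<in> O[at 0](\<lambda>_. 1)"
      unfolding diff using H_0[of 0] by (intro sum_in_bigo) auto
    have "R \<in> O[at_infinity](\<lambda>z. z powi (- 1))"
      by (rule landau_o.big_trans[OF R_inf powi_bigo_at_infinity])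
    then show "(\<lambda>z. \<psi> z - second_kind_fun \<mu> \<phi> z) \<in> O[at_infinity](\<lambda>z. z powi (- 1))"
      unfolding diff using H_inf[of 0] by (intro sum_in_bigo) auto
  qed
  have RH: "R z = H z" if "z \<noteq> 0" for z
    using eq[OF that] by (simp add: R_def H_def)
  have "\<forall>\<^sub>F z in at 0. R z = H z"
    using eventually_neq_at_within[of 0 0 UNIV] by eventually_elim (rule RH)
  then have "H \<in> O[at 0](\<lambda>z. z ^ l)"
    using R_0 by (simp add: landau_o.big.in_cong)
  from sum_in_bigo(2)[OF this H_0[of l]]
  have c_0: "(LINT w|\<mu>. \<phi> w * w powi (- int k)) = 0" if "k < l" for k
    using coeffs_eq_0_if_bigo_at_0[of "\<lambda>k. 2 * (LINT w|\<mu>. \<phi> w * w powi (- int k))" l k] that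
    by simp
  have "\<forall>\<^sub>F z in at_infinity. R z = H z"
    using eventually_not_equal_at_infinity[of 0] by eventually_elim (rule RH)
  then have "H \<in> O[at_infinity](\<lambda>z. z powi (- int l - 1))"
    using R_inf by (simp add: landau_o.big.in_cong)
  from sum_in_bigo(2)[OF this H_inf[of l]]
  have c_inf: "(LINT w|\<mu>. \<phi> w * w powi (int k + 1)) = 0" if "k < l" for k
    using coeffs_eq_0_if_bigo_at_infinity[of "\<lambda>k. - 2 * (LINT w|\<mu>. \<phi> w * w powi (int k + 1))" l k]
      that by simp
  show "(LINT z|\<mu>. \<phi> z * z powi (- k)) = 0" if "k \<in> {- int l..int l - 1}" for k
  proof (cases "k \<ge> 0")
    case True
    then show ?thesis
      using c_0[of "nat k"] that by auto
  next
    case False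
    \<comment> \<open>For negative \<open>k\<close> the exponent \<open>- k\<close> is
      \<open>int i + 1\<close> with \<open>i = nat (- k - 1)\<close>, and
      \<open>k \<ge> - int l\<close> becomes \<open>i < l\<close>.\<close>
    then show ?thesis
      using c_inf[of "nat (- k - 1)"] that by (auto simp: nat_less_iff)
  qed
qed

text \<open>The relations with \<open>k\<close> from 0 to \<open>l - 1\<close> annihilate the
  partial sum at 0, those with \<open>k\<close> from \<open>- l\<close> to -1 the one at infinity;
  only the error terms remain.\<close>

lemma remainder_bigo_if_orthogonal:
  assumes \<mu>: "prob_measure_on_circle \<mu>" and \<phi>: "\<phi> \<in> laurent_span N"
    and ortho: "\<And>k. k \<in> {- int l..int l - 1} \<Longrightarrow> (LINT z|\<mu>. \<phi> z * z powi (- k)) = 0"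
  shows "(\<lambda>z. \<phi> z * caratheodory_fun \<mu> z + second_kind_fun \<mu> \<phi> z) \<in> O[at 0](\<lambda>z. z ^ l)"
    and "(\<lambda>z. \<phi> z * caratheodory_fun \<mu> z + second_kind_fun \<mu> \<phi> z)
      \<in> O[at_infinity](\<lambda>z. z powi (- int l - 1))"
proof -
  have "(\<Sum>k<l. 2 * (LINT w|\<mu>. \<phi> w * w powi (- int k)) * z ^ k) = 0" for z
    by (rule sum.neutral) (use ortho in force)
  then show "(\<lambda>z. \<phi> z * caratheodory_fun \<mu> z + second_kind_fun \<mu> \<phi> z) \<in> O[at 0](\<lambda>z. z ^ l)"
    using remainder_expansion_at_0[OF \<mu> \<phi>, of l] by simp
  have "(LINT w|\<mu>. \<phi> w * w powi (int k + 1)) = 0" if "k < l" for k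
    using ortho[of "- int k - 1"] that by (simp add: add.commute)
  then have "(\<Sum>k<l. - 2 * (LINT w|\<mu>. \<phi> w * w powi (int k + 1)) * z powi (- int k - 1)) = 0" for z
    by simp
  then show "(\<lambda>z. \<phi> z * caratheodory_fun \<mu> z + second_kind_fun \<mu> \<phi> z)
      \<in> O[at_infinity](\<lambda>z. z powi (- int l - 1))"
    using remainder_expansion_at_infinity[OF \<mu> \<phi>, of l] by simp
qed

theorem theorem6p1:
  fixes r :: nat and n :: "nat \<Rightarrow> nat" and \<mu> :: "nat \<Rightarrow> complex measure"
  assumes "\<And>j. j \<in> {1..r} \<Longrightarrow> prob_measure_on_circle (\<mu> j)"
    and "\<And>j. j \<in> {1..r} \<Longrightarrow> even (n j)"
  shows "(\<forall>\<phi> \<psi>. hermite_pade_solution r n \<mu> \<phi> \<psi> \<longrightarrow>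
            orthogonality_relations r n \<mu> \<phi> \<and>
            (\<forall>j\<in>{1..r}. \<forall>z. z \<noteq> 0 \<longrightarrow> \<psi> j z = second_kind_fun (\<mu> j) \<phi> z)) \<and>
         (\<forall>\<phi>. \<phi> \<in> laurent_span ((\<Sum>j=1..r. n j) div 2) \<and> orthogonality_relations r n \<mu> \<phi> \<longrightarrow>
            hermite_pade_solution r n \<mu> \<phi> (\<lambda>j. second_kind_fun (\<mu> j) \<phi>))"
proof (intro conjI allI impI)
  fix \<phi> \<psi>
  assume sol: "hermite_pade_solution r n \<mu> \<phi> \<psi>"
  show "orthogonality_relations r n \<mu> \<phi>"
    using sol remainder_bigo_imp(2)[OF assms(1)]
    unfolding hermite_pade_solution_def orthogonality_relations_def by blast
  show "\<forall>j\<in>{1..r}. \<forall>z. z \<noteq> 0 \<longrightarrow> \<psi> j z = second_kind_fun (\<mu> j) \<phi> z"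
    using sol remainder_bigo_imp(1)[OF assms(1)]
    unfolding hermite_pade_solution_def by blast
next
  fix \<phi>
  assume "\<phi> \<in> laurent_span ((\<Sum>j=1..r. n j) div 2) \<and> orthogonality_relations r n \<mu> \<phi>"
  then show "hermite_pade_solution r n \<mu> \<phi> (\<lambda>j. second_kind_fun (\<mu> j) \<phi>)"
    using remainder_bigo_if_orthogonal[OF assms(1)] second_kind_fun_in_laurent_span[OF assms(1)]
    unfolding hermite_pade_solution_def orthogonality_relations_def by blast
qed

end
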